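(* Let $\{Y_j\}$ be a sequence of i.i.d. Bernoulli variables with parameter $b$. Let $M$ be a random variable with values in $\{0,1,2,\dots\}$, independent of $\{Y_j\}$, with probability generating function $P(s)$ satisfying $$\lim_{s\to 1}\frac{-\log P(s)}{(1-s)^\alpha}=\lambda,$$ where $\lambda$ is a positive constant and $0<\alpha\le 1$. Define $X=\sum_{j=1}^{M}Y_j$, and let the $X_i$ be independent copies of $X$ and the $M_i$ independent copies of $M$. Then the condition $$\sum_{i=1}^{m}M_i\stackrel{d}{=}\sum_{i=1}^{n}X_i$$ characterizes the $\alpha$-Poisson law (as the law of $M$). In this case, the condition $n>m$ should be satisfied.
   Context: Here $m,n$ are positive integers and $\stackrel{d}{=}$ denotes equality in distribution. The $\alpha$-Poisson law is the distribution on $\{0,1,2,\dots\}$ with probability generating function $\exp\{-\lambda(1-s)^\alpha\}$, $\lambda>0$, $0<\alpha\le 1$.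
   Formalization: The Bernoulli parameter is taken with b < 1 (for b = 1 and m = n the condition holds for every M), and "characterizes" means that the condition holds iff M is α-Poisson with these α, λ and m = n b^α, a relation without which the converse fails. *)

theory Defs
  imports "HOL-Probability.Probability"
begin

definition law :: "'a measure \<Rightarrow> ('a \<Rightarrow> nat) \<Rightarrow> nat measure" where
  "law S X = distr S (count_space UNIV) X"

text \<open>The library's \<^term>\<open>prob_space.indep_var\<close> requires both variables to have the same
  value type; this is the same notion for a variable and a random element of another type
  (here a whole sequence): independence of the generated sigma-algebras.\<close>

definition indep_rvs ::
  "'a measure \<Rightarrow> 'b measure \<Rightarrow> ('a \<Rightarrow> 'b) \<Rightarrow> 'c measure \<Rightarrow> ('a \<Rightarrow> 'c) \<Rightarrow> bool" where
  "indep_rvs S A U B V \<longleftrightarrow>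
     U \<in> measurable S A \<and> V \<in> measurable S B \<and>
     prob_space.indep_set S (sets (vimage_algebra (space S) U A))
                            (sets (vimage_algebra (space S) V B))"

definition pgf :: "nat measure \<Rightarrow> real \<Rightarrow> real" where
  "pgf D s = (LINT k|D. s ^ k)"

text \<open>The generating function is prescribed on its whole guaranteed interval of convergence;
  there the base of the real power is nonnegative, and \<^term>\<open>0 powr \<alpha> = 0\<close> is the
  right value at 1 because the exponent is positive.\<close>

definition alpha_poisson :: "real \<Rightarrow> real \<Rightarrow> nat measure \<Rightarrow> bool" where
  "alpha_poisson \<alpha> lam D \<longleftrightarrow>
     0 < \<alpha> \<and> \<alpha> \<le> 1 \<and> 0 < lam \<and>
     prob_space D \<and> sets D = UNIV \<and>
     (\<forall>s. \<bar>s\<bar> \<le> 1 \<longrightarrow> pgf D s = exp (- lam * (1 - s) powr \<alpha>))"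

end

theory Submission imports Defs begin

text \<open>Let P be the generating function of M. Conditioning on the value of M shows that X has
  generating function P(1 - b + b s) (\<open>pgf_law_random_sum\<close>), and independence turns
  sums of copies into powers (\<open>pgf_law_sum\<close>). As a generating function on [-1,1]
  determines the law (\<open>pgf_law_inject\<close>), the equality of laws is the functional
  equation P(s)^m = P(1 - b + b s)^n. The map s -> 1 - b + b s contracts towards its fixed point 1,
  where the limit hypothesis prescribes -log P to leading order; iterating the equation carries this
  behaviour back to every s and also forces m = n b^\<alpha>
  (\<open>stable_functional_equation\<close>). Conversely, thinning multiplies lam (1 - s)^\<alpha>
  by b^\<alpha>, so under this relation the \<alpha>-Poisson law solves the equation. Since b < 1,
  the relation gives m < n.\<close>

text \<open>Countable conditioning on \<open>N\<close>: it yields the power series of a generating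
  function, and it reduces a sum of random length to sums of fixed length.\<close>

lemma sums_integral_level_sets:
  fixes f :: "'a \<Rightarrow> real" and N :: "'a \<Rightarrow> nat"
  assumes f: "integrable M f" and N [measurable]: "N \<in> measurable M (count_space UNIV)"
  shows "(\<lambda>k. \<integral>x. indicator {k} (N x) * f x \<partial>M) sums (\<integral>x. f x \<partial>M)"
proof -
  note [measurable] = borel_measurable_integrable[OF f]
  have [measurable]: "(\<lambda>x. indicator {k} (N x) :: real) \<in> borel_measurable M" for k
    by (rule measurable_compose[OF N]) simp
  have int: "integrable M (\<lambda>x. indicator {k} (N x) * f x)" for k
    by (rule Bochner_Integration.integrable_bound[OF f]) (auto split: split_indicator)
  \<comment> \<open>At each \<open>x\<close> only the term \<open>k = N x\<close> can survive, so
    the partial sums are truncations of \<open>f\<close>, dominated by its absolute value.\<close>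
  have part: "(\<Sum>k<n. indicator {k} (N x) * f x) = (if N x < n then f x else 0)" for n x
    by (auto simp: indicator_def if_distrib cong: if_cong)
  have "(\<lambda>n. \<integral>x. (\<Sum>k<n. indicator {k} (N x) * f x) \<partial>M) \<longlonglongrightarrow> (\<integral>x. f x \<partial>M)"
  proof (rule integral_dominated_convergence[where w = "\<lambda>x. \<bar>f x\<bar>"])
    have "(\<lambda>n. if N x < n then f x else 0) \<longlonglongrightarrow> f x" for x
      by (rule tendsto_eventually) (use eventually_gt_at_top[of "N x"] in eventually_elim, auto)
    then show "AE x in M. (\<lambda>n. \<Sum>k<n. indicator {k} (N x) * f x) \<longlonglongrightarrow> f x"
      unfolding part by simp
    show "AE x in M. norm (\<Sum>k<n. indicator {k} (N x) * f x) \<le> \<bar>f x\<bar>" for n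
      unfolding part by simp
  qed (use f in auto)
  moreover have "(\<integral>x. (\<Sum>k<n. indicator {k} (N x) * f x) \<partial>M)
      = (\<Sum>k<n. \<integral>x. indicator {k} (N x) * f x \<partial>M)" for n
    by (rule Bochner_Integration.integral_sum) (rule int)
  ultimately show ?thesis
    unfolding sums_def by (simp only:)
qed

section \<open>Generating functions of laws on the natural numbers\<close>

context prob_space
begin

lemma integrable_power_rv:
  fixes s :: real
  assumes [measurable]: "N \<in> measurable M (count_space UNIV)" and "\<bar>s\<bar> \<le> 1"
  shows "integrable M (\<lambda>x. s ^ N x)"
  by (rule integrable_const_bound[of _ 1]) (auto simp: power_abs power_le_one assms)

lemma pgf_law:
  assumes [measurable]: "N \<in> measurable M (count_space UNIV)"
  shows "pgf (law M N) s = (\<integral>x. s ^ N x \<partial>M)"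
  unfolding pgf_def law_def by (subst integral_distr) auto

lemma prob_space_law: "N \<in> measurable M (count_space UNIV) \<Longrightarrow> prob_space (law M N)"
  unfolding law_def by (rule prob_space_distr)

lemma sums_pgf_law:
  assumes [measurable]: "N \<in> measurable M (count_space UNIV)" and s: "\<bar>s\<bar> \<le> 1"
  shows "(\<lambda>k. measure (law M N) {k} * s ^ k) sums pgf (law M N) s"
proof -
  have "(\<integral>x. indicator {k} (N x) * s ^ N x \<partial>M) = measure (law M N) {k} * s ^ k" for k
  proof -
    have "(\<integral>x. indicator {k} (N x) * s ^ N x \<partial>M) =
        (\<integral>x. s ^ k * indicator (N -` {k} \<inter> space M) x \<partial>M)"
      by (rule Bochner_Integration.integral_cong) (auto split: split_indicator)
    then show ?thesis
      by (simp add: law_def measure_distr)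
  qed
  with sums_integral_level_sets[OF integrable_power_rv[OF assms] assms(1)] show ?thesis
    by (simp add: pgf_law)
qed

text \<open>All powers are bounded by 1 on the closed interval, so dominated convergence applies up
  to the endpoints. The endpoint 1 is the one the later iteration converges to.\<close>

lemma continuous_on_pgf_law:
  assumes [measurable]: "N \<in> measurable M (count_space UNIV)"
  shows "continuous_on {-1..1} (pgf (law M N))"
  unfolding continuous_on_sequentially
proof (intro allI impI ballI)
  fix s and u :: "nat \<Rightarrow> real"
  assume u: "(\<forall>n. u n \<in> {-1..1}) \<and> u \<longlonglongrightarrow> s"
  have bd: "\<bar>u n\<bar> ^ k \<le> 1" for n k
    using u by (intro power_le_one) (auto simp: abs_le_iff minus_le_iff)
  show "(pgf (law M N) \<circ> u) \<longlonglongrightarrow> pgf (law M N) s"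
    unfolding comp_def pgf_law[OF assms]
    by (rule integral_dominated_convergence[where w = "\<lambda>_. 1"])
       (use u bd in \<open>auto intro!: tendsto_power simp: power_abs\<close>)
qed

lemma pgf_law_1:
  assumes "N \<in> measurable M (count_space UNIV)"
  shows "pgf (law M N) 1 = 1"
  by (simp add: pgf_law[OF assms] prob_space)

text \<open>Identity theorem for power series: the difference of the generating functions has the
  differences of the point masses as coefficients, and point masses determine a measure on a
  countable set.\<close>

lemma pgf_law_inject:
  assumes A: "A \<in> measurable M (count_space UNIV)" and B: "B \<in> measurable M (count_space UNIV)"
    and eq: "\<And>s. \<bar>s\<bar> \<le> 1 \<Longrightarrow> pgf (law M A) s = pgf (law M B) s"
  shows "law M A = law M B"
proof -
  interpret A: prob_space "law M A" by (rule prob_space_law[OF A])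
  interpret B: prob_space "law M B" by (rule prob_space_law[OF B])
  define a where "a k = measure (law M A) {k} - measure (law M B) {k}" for k
  have sums: "(\<lambda>k. a k * s ^ k) sums 0" if "\<bar>s\<bar> \<le> 1" for s
    using sums_diff[OF sums_pgf_law[OF A that] sums_pgf_law[OF B that]] eq[OF that]
    by (simp add: a_def left_diff_distrib)
  have "a k = 0" for k
  proof (induction k rule: less_induct)
    case (less k)
    \<comment> \<open>By induction the coefficients below \<open>k\<close> vanish, so dividing by
      \<open>s ^ k\<close> leaves a series with constant term \<open>a k\<close>. Its sum is 0 away
      from the origin, hence also in the limit at 0.\<close>
    have "(\<lambda>j. a (j + k) * s ^ j) sums 0" if s: "s \<noteq> 0" "\<bar>s\<bar> < 1" for s
    proof -
      have "(\<lambda>j. a (j + k) * s ^ (j + k)) sums 0"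
        using sums[of s] less s by (subst sums_iff_shift) simp
      from sums_divide[OF this, of "s ^ k"] show ?thesis
        using s by (simp add: power_add)
    qed
    then have "((\<lambda>_. 0) \<longlongrightarrow> a (0 + k)) (at (0::real))"
      by (intro powser_limit_0_strong[where s = 1]) auto
    then show ?case
      by (simp add: tendsto_const_iff)
  qed
  then have "emeasure (law M A) {k} = emeasure (law M B) {k}" for k
    by (simp add: a_def A.emeasure_eq_measure B.emeasure_eq_measure)
  then show ?thesis
    by (intro measure_eqI_countable[where A = UNIV]) (auto simp: law_def)
qed

lemma pgf_law_sum:
  assumes "finite I" and ind: "indep_vars (\<lambda>_. count_space UNIV) N I" and s: "\<bar>s\<bar> \<le> 1"
  shows "pgf (law M (\<lambda>x. \<Sum>i\<in>I. N i x)) s = (\<Prod>i\<in>I. pgf (law M (N i)) s)"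
proof -
  have rv [measurable]: "N i \<in> measurable M (count_space UNIV)" if "i \<in> I" for i
    using ind that by (auto simp: indep_vars_def)
  have "indep_vars (\<lambda>_. borel) (\<lambda>i x. s ^ N i x) I"
    by (rule indep_vars_compose2[OF ind]) auto
  then have "(\<integral>x. (\<Prod>i\<in>I. s ^ N i x) \<partial>M) = (\<Prod>i\<in>I. \<integral>x. s ^ N i x \<partial>M)"
    using \<open>finite I\<close> by (intro indep_vars_lebesgue_integral) (auto intro: integrable_power_rv rv s)
  moreover have "(\<lambda>x. \<Sum>i\<in>I. N i x) \<in> measurable M (count_space UNIV)"
    by measurable
  ultimately show ?thesis
    by (simp add: pgf_law rv power_sum)
qed

section \<open>Independence and sums of random length\<close>

text \<open>A function of \<open>U\<close> generates a smaller sigma-algebra than \<open>U\<close>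
  itself. This leads from independence across different value types to \<open>indep_var\<close>,
  once both sides are mapped into a common type.\<close>

lemma indep_rvs_compose:
  assumes "indep_rvs M A U B V" and f: "f \<in> measurable A C" and g: "g \<in> measurable B D"
  shows "indep_var C (\<lambda>x. f (U x)) D (\<lambda>x. g (V x))"
proof -
  have U: "U \<in> measurable M A" and V: "V \<in> measurable M B"
    and ind: "indep_set (sets (vimage_algebra (space M) U A)) (sets (vimage_algebra (space M) V B))"
    using assms(1) by (auto simp: indep_rvs_def)
  have sub: "sigma_sets (space M) {(\<lambda>x. h (W x)) -` F \<inter> space M | F. F \<in> sets E'}
      \<subseteq> sets (vimage_algebra (space M) W E)"
    if h: "h \<in> measurable E E'" and W: "W \<in> measurable M E" for h W E E'
  proof -
    have "(\<lambda>x. h (W x)) -` F \<inter> space M \<in> sets (vimage_algebra (space M) W E)"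
      if "F \<in> sets E'" for F
    proof -
      have "(\<lambda>x. h (W x)) -` F \<inter> space M = W -` (h -` F \<inter> space E) \<inter> space M"
        using measurable_space[OF W] by auto
      then show ?thesis
        using measurable_sets[OF h that] by (simp only: in_vimage_algebra)
    qed
    then have "{(\<lambda>x. h (W x)) -` F \<inter> space M | F. F \<in> sets E'}
        \<subseteq> sets (vimage_algebra (space M) W E)"
      by auto
    from sets.sigma_sets_subset[OF this] show ?thesis
      by simp
  qed
  from ind have "indep_set
      (sigma_sets (space M) {(\<lambda>x. f (U x)) -` F \<inter> space M | F. F \<in> sets C})
      (sigma_sets (space M) {(\<lambda>x. g (V x)) -` F \<inter> space M | F. F \<in> sets D})"
    unfolding indep_set_def
    by (rule indep_sets_mono_sets) (use sub[OF f U] sub[OF g V] in \<open>auto split: bool.splits\<close>)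
  then show ?thesis
    unfolding indep_var_eq using measurable_compose[OF U f] measurable_compose[OF V g] by simp
qed

lemma measurable_random_sum:
  fixes Y :: "nat \<Rightarrow> 'a \<Rightarrow> nat"
  assumes N: "N \<in> measurable M (count_space UNIV)"
    and Y [measurable]: "\<And>j. j \<ge> 1 \<Longrightarrow> Y j \<in> measurable M (count_space UNIV)"
  shows "(\<lambda>x. \<Sum>j = 1..N x. Y j x) \<in> measurable M (count_space UNIV)"
  by (rule measurable_compose_countable[OF _ N]) measurable

text \<open>On the event \<open>N = k\<close> the sum has exactly \<open>k\<close> terms, which are
  independent of that event, so the event contributes its probability times \<open>t ^ k\<close>;
  summing over \<open>k\<close> gives the generating function of \<open>N\<close> at
  \<open>t\<close>.\<close>

lemma pgf_law_random_sum:
  fixes Y :: "nat \<Rightarrow> 'a \<Rightarrow> nat"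
  assumes ind: "indep_vars (\<lambda>_. count_space UNIV) Y {1..}"
    and indN: "indep_rvs M (count_space UNIV) N (\<Pi>\<^sub>M j\<in>{1..}. count_space UNIV)
          (\<lambda>x. \<lambda>j\<in>{1..}. Y j x)"
    and s: "\<bar>s\<bar> \<le> 1" and t: "\<And>j. j \<ge> 1 \<Longrightarrow> pgf (law M (Y j)) s = t" "\<bar>t\<bar> \<le> 1"
  shows "pgf (law M (\<lambda>x. \<Sum>j = 1..N x. Y j x)) s = pgf (law M N) t"
proof -
  let ?X = "\<lambda>x. \<Sum>j = 1..N x. Y j x"
  have Y [measurable]: "Y j \<in> measurable M (count_space UNIV)" if "j \<ge> 1" for j
    using ind that by (auto simp: indep_vars_def)
  have N [measurable]: "N \<in> measurable M (count_space UNIV)"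
    using indN by (simp add: indep_rvs_def)
  have X: "?X \<in> measurable M (count_space UNIV)"
    by (rule measurable_random_sum) auto
  have "(\<integral>x. indicator {k} (N x) * s ^ ?X x \<partial>M) = (\<integral>x. indicator {k} (N x) * t ^ N x \<partial>M)" for k
  proof -
    let ?V = "\<lambda>x. s ^ (\<Sum>j = 1..k. Y j x)"
    \<comment> \<open>Writing the sum through the restricted sequence exhibits it as a function of
      the second element in \<open>indN\<close>; on \<open>{1..k}\<close> the restriction changes
      nothing.\<close>
    have "indep_var borel (\<lambda>x. indicator {k} (N x) :: real)
            borel (\<lambda>x. s ^ (\<Sum>j = 1..k. (\<lambda>j\<in>{1..}. Y j x) j))"
      by (rule indep_rvs_compose[OF indN]) measurable
    then have iv: "indep_var borel (\<lambda>x. indicator {k} (N x) :: real) borel ?V"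
      by simp
    have S [measurable]: "(\<lambda>x. \<Sum>j = 1..k. Y j x) \<in> measurable M (count_space UNIV)"
      by measurable
    have V: "(\<integral>x. ?V x \<partial>M) = t ^ k"
      unfolding pgf_law[OF S, symmetric]
      by (subst pgf_law_sum[OF _ indep_vars_subset[OF ind] s]) (auto simp: t)
    have [measurable]: "(\<lambda>x. indicator {k} (N x) :: real) \<in> borel_measurable M"
      by (rule measurable_compose[OF N]) simp
    have "integrable M (\<lambda>x. indicator {k} (N x) :: real)"
      by (intro integrable_const_bound[of _ 1]) (auto split: split_indicator)
    from indep_var_lebesgue_integral[OF iv this integrable_power_rv[OF S s]]
    have "(\<integral>x. indicator {k} (N x) * ?V x \<partial>M) = (\<integral>x. indicator {k} (N x) \<partial>M) * t ^ k"
      by (simp only: V)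
    also have "\<dots> = (\<integral>x. indicator {k} (N x) * t ^ k \<partial>M)"
      by simp
    also have "\<dots> = (\<integral>x. indicator {k} (N x) * t ^ N x \<partial>M)"
      by (rule Bochner_Integration.integral_cong) (auto split: split_indicator)
    moreover have "(\<integral>x. indicator {k} (N x) * s ^ ?X x \<partial>M) = (\<integral>x. indicator {k} (N x) * ?V x \<partial>M)"
      by (rule Bochner_Integration.integral_cong) (auto split: split_indicator)
    ultimately show ?thesis by simp
  qed
  with sums_integral_level_sets[OF integrable_power_rv[OF X s] N]
    sums_integral_level_sets[OF integrable_power_rv[OF N t(2)] N] show ?thesis
    unfolding pgf_law[OF X] pgf_law[OF N] by (auto intro: sums_unique2)
qed

end

section \<open>Thinning and its functional equation\<close>

lemma pgf_bernoulli:
  assumes "0 \<le> b" "b \<le> 1"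
  shows "pgf (measure_pmf (map_pmf of_bool (bernoulli_pmf b))) s = 1 - b + b * s"
  using assms by (simp add: pgf_def)

text \<open>In the coordinate \<open>u = 1 - s\<close> the functional equation reads \<open>m g(u) = n g(b u)\<close> for
  \<open>g(u) = - ln P(1 - u)\<close>, that is \<open>h(u) = c h(b u)\<close> for \<open>h(u) = g(u) / u\<^sup>\<alpha>\<close> and \<open>c = n b\<^sup>\<alpha> / m\<close>.
  Letting \<open>u\<close> tend to 0 forces \<open>c = 1\<close>, so \<open>h\<close> is constant along \<open>b\<^sup>k u\<close> and equals its limit.  As \<open>b u\<close> stays in \<open>[0, 2]\<close>, the iteration covers negative \<open>s\<close> too.\<close>

lemma stable_functional_equation:
  fixes P :: "real \<Rightarrow> real"
  assumes b: "0 \<le> b" "b < 1" and m: "m \<ge> 1" and n: "n \<ge> 1" and \<alpha>: "0 < \<alpha>" and lam: "0 < lam"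
    and cont: "continuous_on {-1..1} P" and P1: "P 1 = 1"
    and lim: "((\<lambda>s. - ln (P s) / (1 - s) powr \<alpha>) \<longlongrightarrow> lam) (at_left 1)"
    and eq: "\<And>s. \<bar>s\<bar> \<le> 1 \<Longrightarrow> P s ^ m = P (1 - b + b * s) ^ n"
  shows "real m = real n * b powr \<alpha>"
    and "\<And>s. \<bar>s\<bar> \<le> 1 \<Longrightarrow> P s = exp (- lam * (1 - s) powr \<alpha>)"
proof -
  have bk: "0 \<le> b ^ k * u \<and> b ^ k * u \<le> 2" if "0 \<le> u" "u \<le> 2" for k u
    using that b mult_mono[of "b ^ k" 1 u 2] by (auto simp: power_le_one)
  have eq': "P (1 - u) ^ m = P (1 - b * u) ^ n" if "0 \<le> u" "u \<le> 2" for u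
    using eq[of "1 - u"] that by (simp add: algebra_simps abs_le_iff)
  have b0: "(\<lambda>k. b ^ k * u) \<longlonglongrightarrow> 0" for u
    using tendsto_mult_right[OF LIMSEQ_realpow_zero[OF b], of u] by simp
  have b0': "(\<lambda>k. 1 - b ^ k * u) \<longlonglongrightarrow> 1" for u
    using tendsto_diff[OF tendsto_const b0, of 1 u] by simp
  \<comment> \<open>A zero would propagate along \<open>b ^ k * u\<close> towards 0, and continuity
    would then give \<open>P 1 = 0\<close>.\<close>
  have nz: "P (1 - u) \<noteq> 0" if u: "0 \<le> u" "u \<le> 2" for u
  proof
    assume z: "P (1 - u) = 0"
    have "P (1 - b ^ k * u) = 0" for k
    proof (induction k)
      case (Suc k)
      with eq'[of "b ^ k * u"] bk[OF u, of k] m n show ?case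
        by (simp add: power_0_left mult.assoc)
    qed (use z in simp)
    moreover have "(\<lambda>k. P (1 - b ^ k * u)) \<longlonglongrightarrow> P 1"
      by (rule continuous_on_tendsto_compose[OF cont])
         (use bk[OF u] in \<open>auto intro: b0'\<close>)
    ultimately show False
      using P1 by (simp add: tendsto_const_iff)
  qed
  \<comment> \<open>\<open>ln\<close> needs positive arguments, and even exponents in
    \<open>eq\<close> would hide a sign. Having no zeros and the value 1 at 1, \<open>P\<close> is
    positive by the intermediate value theorem.\<close>
  have pos: "P s > 0" if s: "-1 \<le> s" "s \<le> 1" for s
  proof (rule ccontr)
    assume "\<not> P s > 0"
    then obtain t where "s \<le> t" "t \<le> 1" "P t = 0"
      using IVT'[of P s 0 1] s P1 continuous_on_subset[OF cont, of "{s..1}"] by auto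
    with nz[of "1 - t"] s show False by simp
  qed
  \<comment> \<open>\<open>h 0\<close> is the default value 0 of a division by zero, not
    \<open>lam\<close>; the statements on \<open>h\<close> therefore keep \<open>u\<close>
    positive.\<close>
  define h where "h u = - ln (P (1 - u)) / u powr \<alpha>" for u
  define c where "c = real n * b powr \<alpha> / real m"
  have "((\<lambda>s. h (1 - s)) \<longlongrightarrow> lam) (at_left 1)"
    using lim by (simp add: h_def)
  moreover have "filterlim (\<lambda>u::real. 1 - u) (at_left 1) (at_right 0)"
    by (auto intro!: filterlim_at_withinI tendsto_eq_intros eventually_at_rightI[of 0 1])
  ultimately have hlim: "(h \<longlongrightarrow> lam) (at_right 0)"
    using filterlim_compose[of "\<lambda>s. h (1 - s)"] by fastforce
  have log: "m * ln (P (1 - u)) = n * ln (P (1 - b * u))" if "0 \<le> u" "u \<le> 2" for u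
  proof -
    have "ln (P (1 - u) ^ m) = ln (P (1 - b * u) ^ n)"
      using eq'[OF that] by simp
    moreover have "b * u \<le> 2" "0 \<le> b * u"
      using bk[OF that, of 1] by auto
    ultimately show ?thesis
      using that pos[of "1 - u"] pos[of "1 - b * u"] by (simp add: ln_realpow)
  qed
  \<comment> \<open>For \<open>b = 0\<close> the logarithmic equation has
    \<open>ln (P 1) = 0\<close> on the right, so \<open>h\<close> vanishes near 0, against its
    positive limit.\<close>
  have b_pos: "b > 0"
  proof (rule ccontr)
    assume "\<not> b > 0"
    then have "ln (P (1 - u)) = 0" if "0 \<le> u" "u \<le> 2" for u
      using log[OF that] b P1 m by simp
    then have "eventually (\<lambda>u. h u = 0) (at_right 0)"
      by (intro eventually_at_rightI[of 0 1]) (auto simp: h_def)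
    with hlim have "((\<lambda>_. 0) \<longlongrightarrow> lam) (at_right (0::real))"
      by (rule Lim_transform_eventually)
    then show False
      using lam by (simp add: tendsto_const_iff)
  qed
  have h_step: "h u = c * h (b * u)" if "0 < u" "u \<le> 2" for u
    using log[of u] that b_pos m by (simp add: h_def c_def powr_mult field_simps)
  have scaled: "((\<lambda>u. h (b * u)) \<longlongrightarrow> lam) (at_right 0)"
    by (rule filterlim_compose[OF hlim])
       (use b_pos in \<open>auto intro!: filterlim_at_withinI tendsto_eq_intros
          eventually_at_rightI[of 0 1]\<close>)
  have "eventually (\<lambda>u. h u = c * h (b * u)) (at_right 0)"
    by (intro eventually_at_rightI[of 0 1] h_step) auto
  with hlim have "((\<lambda>u. c * h (b * u)) \<longlongrightarrow> lam) (at_right 0)"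
    by (rule Lim_transform_eventually)
  moreover have "((\<lambda>u. c * h (b * u)) \<longlongrightarrow> c * lam) (at_right 0)"
    by (intro tendsto_intros scaled)
  ultimately have "lam = c * lam"
    by (rule tendsto_unique[rotated]) simp
  with lam have c: "c = 1" by simp
  then show "real m = real n * b powr \<alpha>"
    using m by (simp add: c_def field_simps)
  have h_const: "h u = lam" if u: "0 < u" "u \<le> 2" for u
  proof -
    have "h (b ^ k * u) = h u" for k
    proof (induction k)
      case (Suc k)
      with h_step[of "b ^ k * u"] bk[of u k] u b_pos c show ?case
        by (simp add: mult.assoc)
    qed simp
    moreover have "(\<lambda>k. h (b ^ k * u)) \<longlonglongrightarrow> lam"
      by (rule filterlim_compose[OF hlim])
         (use b_pos u in \<open>auto intro!: filterlim_at_withinI b0 always_eventually\<close>)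
    ultimately show ?thesis
      by (simp add: tendsto_const_iff)
  qed
  show "P s = exp (- lam * (1 - s) powr \<alpha>)" if "\<bar>s\<bar> \<le> 1" for s
  \<comment> \<open>\<open>h_const\<close> does not reach \<open>s = 1\<close>; there both sides are
    1, as \<open>0 powr \<alpha> = 0\<close>.\<close>
  proof (cases "s = 1")
    case False
    with that have "0 < 1 - s" "1 - s \<le> 2" by auto
    with h_const[of "1 - s"] have "ln (P s) = - lam * (1 - s) powr \<alpha>"
      by (simp add: h_def field_simps)
    with pos[of s] that show ?thesis
      by (metis abs_le_iff exp_ln minus_le_iff)
  qed (use P1 in simp)
qed

section \<open>The characterization of the \<alpha>-Poisson law\<close>

text \<open>The balance \<open>real m = real n * b powr \<alpha>\<close> makes the equivalence
  exact: an \<alpha>-Poisson \<open>M\<close> satisfies the equality of laws only for these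
  parameters.\<close>

theorem theorem4p5:
  fixes S :: "'a measure"
    and Y :: "nat \<Rightarrow> 'a \<Rightarrow> nat" and M X :: "'a \<Rightarrow> nat"
    and Mi Xi :: "nat \<Rightarrow> 'a \<Rightarrow> nat"
    and b lam \<alpha> :: real and m n :: nat
  assumes "prob_space S"
    and "m \<ge> 1" and "n \<ge> 1"
    and "0 \<le> b" and "b < 1"
    and "0 < lam" and "0 < \<alpha>" and "\<alpha> \<le> 1"
    and "prob_space.indep_vars S (\<lambda>_. count_space UNIV) Y {1..}"
    and "\<And>j. j \<ge> 1 \<Longrightarrow> law S (Y j) = measure_pmf (map_pmf of_bool (bernoulli_pmf b))"
    and "indep_rvs S (count_space UNIV) M
           (\<Pi>\<^sub>M j\<in>{1..}. count_space UNIV) (\<lambda>\<omega>. \<lambda>j\<in>{1..}. Y j \<omega>)"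
    and "((\<lambda>s. - ln (pgf (law S M) s) / (1 - s) powr \<alpha>) \<longlongrightarrow> lam) (at_left 1)"
    and "X = (\<lambda>\<omega>. \<Sum>j = 1..M \<omega>. Y j \<omega>)"
    and "prob_space.indep_vars S (\<lambda>_. count_space UNIV) Mi {1..m}"
    and "\<And>i. i \<in> {1..m} \<Longrightarrow> law S (Mi i) = law S M"
    and "prob_space.indep_vars S (\<lambda>_. count_space UNIV) Xi {1..n}"
    and "\<And>i. i \<in> {1..n} \<Longrightarrow> law S (Xi i) = law S X"
  shows "(law S (\<lambda>\<omega>. \<Sum>i = 1..m. Mi i \<omega>) = law S (\<lambda>\<omega>. \<Sum>i = 1..n. Xi i \<omega>)
            \<longleftrightarrow> alpha_poisson \<alpha> lam (law S M) \<and> real m = real n * b powr \<alpha>)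
       \<and> (law S (\<lambda>\<omega>. \<Sum>i = 1..m. Mi i \<omega>) = law S (\<lambda>\<omega>. \<Sum>i = 1..n. Xi i \<omega>)
            \<longrightarrow> m < n)"
proof -
  interpret prob_space S by fact
  let ?P = "pgf (law S M)"
  have N: "M \<in> measurable S (count_space UNIV)"
    using assms(11) by (simp add: indep_rvs_def)
  have Mi [measurable]: "Mi i \<in> measurable S (count_space UNIV)" if "i \<in> {1..m}" for i
    using assms(14) that by (auto simp: indep_vars_def)
  have Xi [measurable]: "Xi i \<in> measurable S (count_space UNIV)" if "i \<in> {1..n}" for i
    using assms(16) that by (auto simp: indep_vars_def)
  have pM: "pgf (law S (\<lambda>\<omega>. \<Sum>i = 1..m. Mi i \<omega>)) s = ?P s ^ m" if "\<bar>s\<bar> \<le> 1" for s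
  proof -
    have "(\<Prod>i = 1..m. pgf (law S (Mi i)) s) = (\<Prod>i = 1..m. ?P s)"
      by (rule prod.cong) (simp_all only: assms(15))
    with pgf_law_sum[OF _ assms(14) that] show ?thesis
      by simp
  qed
  have pX: "pgf (law S (\<lambda>\<omega>. \<Sum>i = 1..n. Xi i \<omega>)) s = ?P (1 - b + b * s) ^ n"
    if s: "\<bar>s\<bar> \<le> 1" for s
  proof -
    \<comment> \<open>A convex combination of 1 and \<open>s\<close> stays in [-1,1], where the
      generating function of \<open>M\<close> is controlled.\<close>
    have "\<bar>1 - b + b * s\<bar> \<le> \<bar>1 - b\<bar> + \<bar>b\<bar> * \<bar>s\<bar>"
      unfolding abs_mult[symmetric] by (rule abs_triangle_ineq)
    also have "\<dots> \<le> 1"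
      using mult_left_mono[OF s, of "\<bar>b\<bar>"] assms(4,5) by simp
    finally have "pgf (law S X) s = ?P (1 - b + b * s)"
      unfolding assms(13)
      using assms(4,5) by (intro pgf_law_random_sum[OF assms(9,11) s])
        (simp_all add: assms(10) pgf_bernoulli)
    moreover have "(\<Prod>i = 1..n. pgf (law S (Xi i)) s) = (\<Prod>i = 1..n. pgf (law S X) s)"
      by (rule prod.cong) (simp_all only: assms(17))
    ultimately show ?thesis
      using pgf_law_sum[OF _ assms(16) s] by simp
  qed
  let ?eq = "law S (\<lambda>\<omega>. \<Sum>i = 1..m. Mi i \<omega>) = law S (\<lambda>\<omega>. \<Sum>i = 1..n. Xi i \<omega>)"
  have less: "m < n" if "real m = real n * b powr \<alpha>"
  proof -
    have "b powr \<alpha> < 1"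
      using powr_less_mono2[of \<alpha> b 1] assms(4,5,7) by simp
    then have "real n * b powr \<alpha> < real n * 1"
      using assms(3) by (intro mult_strict_left_mono) auto
    with that show ?thesis by simp
  qed
  have forward: "alpha_poisson \<alpha> lam (law S M) \<and> real m = real n * b powr \<alpha>" if ?eq
  proof -
    have eq: "?P s ^ m = ?P (1 - b + b * s) ^ n" if "\<bar>s\<bar> \<le> 1" for s
      using pM[OF that] pX[OF that] \<open>?eq\<close> by simp
    note * = stable_functional_equation[where P = ?P, OF assms(4,5,2,3,7,6)
      continuous_on_pgf_law[OF N] pgf_law_1[OF N] assms(12) eq]
    show ?thesis
      using * assms(6,7,8) prob_space_law[OF N] by (simp add: alpha_poisson_def law_def)
  qed
  have backward: ?eq if ap: "alpha_poisson \<alpha> lam (law S M)" and mn: "real m = real n * b powr \<alpha>"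
  proof (rule pgf_law_inject)
    fix s :: real assume s: "\<bar>s\<bar> \<le> 1"
    have P: "?P t = exp (- lam * (1 - t) powr \<alpha>)" if "\<bar>t\<bar> \<le> 1" for t
      using ap that by (simp add: alpha_poisson_def)
    have "b * (1 - s) \<le> 1 * 2" "0 \<le> b * (1 - s)"
      using s assms(4,5) by (intro mult_mono, auto)
    then have t: "\<bar>1 - b + b * s\<bar> \<le> 1"
      by (simp add: algebra_simps abs_le_iff)
    \<comment> \<open>Thinning rescales the distance to 1 by \<open>b\<close>, hence the exponent by
      \<open>b powr \<alpha>\<close>; the \<open>n\<close> copies then bring the total factor to
      \<open>m\<close>.\<close>
    have "1 - (1 - b + b * s) = b * (1 - s)"
      by (simp add: algebra_simps)
    moreover have "(b * (1 - s)) powr \<alpha> = b powr \<alpha> * (1 - s) powr \<alpha>"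
      by (rule powr_mult)
    ultimately show "pgf (law S (\<lambda>\<omega>. \<Sum>i = 1..m. Mi i \<omega>)) s =
        pgf (law S (\<lambda>\<omega>. \<Sum>i = 1..n. Xi i \<omega>)) s"
      by (simp only: pM[OF s] pX[OF s] P[OF s] P[OF t] exp_of_nat_mult[symmetric] mn)
         (simp add: mult_ac)
  qed measurable
  from forward backward less show ?thesis by blast
qed

end
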